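(* Let $G$ be a group and $X$ a $G$-space. If a subset $A\subset X$ has positive density $\mathsf{is}_{12}(A)>0$, then $$\mathrm{cov}(\Delta_{\mathcal I}(A))\le\mathrm{pack}_{\mathcal I}(A)\le \frac{1}{\mathsf{is}_{12}(A)}$$ for any $G$-invariant Boolean ideal $\mathcal I$ on $X$ such that $\widehat{\mathsf{is}}_{12}(B)=0$ for all $B\in\mathcal I$.
   Context: A $G$-space is a set $X$ with a left action of $G$. A Boolean ideal on $X$ is a non-empty family $\mathcal I$ of subsets of $X$ such that $A\cup B\in\mathcal I$ and $A\cap C\in\mathcal I$ for all $A,B\in\mathcal I$, $C\subset X$; it is $G$-invariant if $gA\in\mathcal I$ for all $A\in\mathcal I$, $g\in G$. Put $\Delta_{\mathcal I}(A)=\{x\in G:A\cap xA\notin\mathcal I\}$; for non-empty $B\subset G$, $\mathrm{cov}(B)=\min\{|F|:F\subset G,\ G=FB\}$; and $\mathrm{pack}_{\mathcal I}(A)=\sup\{|E|:E\subset G,\ xA\cap yA\in\mathcal I\text{ for any distinct }x,y\in E\}$. $P_\omega(Y)$ denotes the set of finitely supported probability measures on a set $Y$, i.e. convex combinations $\sum_i\alpha_i\delta_{y_i}$ of finitely many Dirac measures. For $\mu=\sum_i\alpha_i\delta_{a_i}\in P_\omega(G)$ and $\nu=\sum_j\beta_j\delta_{x_j}\in P_\omega(X)$ the convolution is $\mu*\nu=\sum_{i,j}\alpha_i\beta_j\delta_{a_ix_j}$. For $A\subset X$, $$\mathsf{is}_{12}(A)=\inf_{\mu_1\in P_\omega(G)}\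 \sup_{\mu_2\in P_\omega(X)}\mu_1*\mu_2(A)=\inf_{\mu\in P_\omega(G)}\sup_{x\in X}\mu*\delta_x(A),$$ and $\widehat{\mathsf{is}}_{12}(A)=\sup_{B\subset X}\big(\mathsf{is}_{12}(A\cup B)-\mathsf{is}_{12}(B)\big)$. *)

theory Defs
  imports
    "HOL-Algebra.Group_Action"
    "HOL-Probability.Probability_Mass_Function"
    "HOL-Library.Extended_Nat"
    "HOL-Library.Extended_Real"
begin

text \<open>
  A \<open>G\<close>-space \<open>X\<close> is a group action \<^term>\<open>group_action G X \<phi>\<close>, where \<open>\<phi> g x\<close> is the point \<open>g x\<close>
  and \<open>\<phi> g ` A\<close> is the translate \<open>g A\<close>.
\<close>

definition boolean_ideal :: "'x set \<Rightarrow> 'x set set \<Rightarrow> bool" where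
  "boolean_ideal X I \<longleftrightarrow>
     I \<subseteq> Pow X \<and> I \<noteq> {} \<and>
     (\<forall>A\<in>I. \<forall>B\<in>I. A \<union> B \<in> I) \<and>
     (\<forall>A\<in>I. \<forall>C. C \<subseteq> X \<longrightarrow> A \<inter> C \<in> I)"

definition invariant_family ::
  "('g, 'm) monoid_scheme \<Rightarrow> ('g \<Rightarrow> 'x \<Rightarrow> 'x) \<Rightarrow> 'x set set \<Rightarrow> bool" where
  "invariant_family G \<phi> I \<longleftrightarrow> (\<forall>A\<in>I. \<forall>g\<in>carrier G. \<phi> g ` A \<in> I)"

definition Delta ::
  "('g, 'm) monoid_scheme \<Rightarrow> ('g \<Rightarrow> 'x \<Rightarrow> 'x) \<Rightarrow> 'x set set \<Rightarrow> 'x set \<Rightarrow> 'g set" where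
  "Delta G \<phi> I A = {g \<in> carrier G. A \<inter> \<phi> g ` A \<notin> I}"

text \<open>
  Cardinalities are taken in \<^typ>\<open>enat\<close>: all infinite cardinals become \<open>\<infinity>\<close>. An inequality whose
  right-hand side is finite means the same as for cardinal numbers.
\<close>

definition ecard :: "'a set \<Rightarrow> enat" where
  "ecard S = (if finite S then enat (card S) else \<infinity>)"

text \<open>
  The order on \<^typ>\<open>enat\<close> is a well-order, so for non-empty \<open>B \<subseteq> carrier G\<close> the infimum is a minimum
  (\<open>F = carrier G\<close> is a candidate). For \<open>B = {}\<close> there is no candidate and the value is \<open>\<infinity>\<close>.
\<close>

definition cov :: "('g, 'm) monoid_scheme \<Rightarrow> 'g set \<Rightarrow> enat" where
  "cov G B = (INF F \<in> {F. F \<subseteq> carrier G \<and> carrier G = F <#>\<^bsub>G\<^esub> B}. ecard F)"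

definition pack ::
  "('g, 'm) monoid_scheme \<Rightarrow> ('g \<Rightarrow> 'x \<Rightarrow> 'x) \<Rightarrow> 'x set set \<Rightarrow> 'x set \<Rightarrow> enat" where
  "pack G \<phi> I A =
     (SUP E \<in> {E. E \<subseteq> carrier G \<and> pairwise (\<lambda>x y. \<phi> x ` A \<inter> \<phi> y ` A \<in> I) E}. ecard E)"

definition fin_prob :: "'a set \<Rightarrow> 'a pmf set" where
  "fin_prob Y = {\<mu>. finite (set_pmf \<mu>) \<and> set_pmf \<mu> \<subseteq> Y}"

definition convolution :: "('g \<Rightarrow> 'x \<Rightarrow> 'x) \<Rightarrow> 'g pmf \<Rightarrow> 'x pmf \<Rightarrow> 'x pmf" where
  "convolution \<phi> \<mu> \<nu> = map_pmf (\<lambda>(a, x). \<phi> a x) (pair_pmf \<mu> \<nu>)"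

text \<open>
  The densities are \<^typ>\<open>ereal\<close>-valued so that suprema and infima are always meaningful. For \<open>X \<noteq> {}\<close>
  the values of \<open>is12\<close> are finite (in \<open>[0, 1]\<close>), so the subtraction in \<open>is12_hat\<close> is that of real
  numbers. For \<open>X = {}\<close> the inner supremum is over the empty set, so \<open>is12\<close> is \<open>-\<infinity>\<close> and no set has
  positive density.
\<close>

definition is12 ::
  "('g, 'm) monoid_scheme \<Rightarrow> 'x set \<Rightarrow> ('g \<Rightarrow> 'x \<Rightarrow> 'x) \<Rightarrow> 'x set \<Rightarrow> ereal" where
  "is12 G X \<phi> A =
     (INF \<mu>\<^sub>1 \<in> fin_prob (carrier G). SUP \<mu>\<^sub>2 \<in> fin_prob X.
        ereal (measure_pmf.prob (convolution \<phi> \<mu>\<^sub>1 \<mu>\<^sub>2) A))"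

definition is12_hat ::
  "('g, 'm) monoid_scheme \<Rightarrow> 'x set \<Rightarrow> ('g \<Rightarrow> 'x \<Rightarrow> 'x) \<Rightarrow> 'x set \<Rightarrow> ereal" where
  "is12_hat G X \<phi> A = (SUP B \<in> Pow X. is12 G X \<phi> (A \<union> B) - is12 G X \<phi> B)"

end

theory Submission
  imports Defs
begin

text \<open>
  If the translates of \<open>A\<close> by a finite set \<open>E\<close> of \<open>n\<close> elements are pairwise disjoint, then the uniform
  measure on the inverses of \<open>E\<close> witnesses that the density of \<open>A\<close> is at most \<open>1 / n\<close>. Sets in the
  ideal do not affect densities, so translates that overlap in sets of the ideal can be made
  disjoint by deleting such a set from \<open>A\<close>; this bounds the packing number. Consequently there is
  a packing \<open>E\<close> of largest size, and its maximality means precisely that \<open>E \<Delta>(A)\<close> is the whole group.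
\<close>

section \<open>Extended cardinalities and packings of largest size\<close>

lemma ecard_leI:
  assumes "\<And>F. finite F \<Longrightarrow> F \<subseteq> E \<Longrightarrow> F \<noteq> {} \<Longrightarrow> real (card F) \<le> c" and "0 \<le> c"
  shows "ereal_of_enat (ecard E) \<le> ereal c"
proof (cases "finite E")
  case True
  then show ?thesis
    using assms by (cases "E = {}") (auto simp: ecard_def)
next
  case False
  \<comment> \<open>An infinite \<open>E\<close> would contain a finite subset with more than
    \<open>c\<close> elements, so this case is contradictory.\<close>
  obtain n :: nat where n: "c < real n"
    using reals_Archimedean2 by blast
  obtain F where F: "finite F" "card F = n" "F \<subseteq> E"
    using infinite_arbitrarily_large[OF False] by metis
  have "F \<noteq> {}"
    using F n assms(2) by auto
  then show ?thesis
    using assms(1)[OF F(1,3)] F(2) n by simp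
qed

lemma pack_ge:
  assumes "E \<subseteq> carrier G" and "pairwise (\<lambda>x y. \<phi> x ` A \<inter> \<phi> y ` A \<in> I) E"
  shows "ecard E \<le> pack G \<phi> I A"
  unfolding pack_def using assms by (auto intro: SUP_upper)

text \<open>In \<open>enat\<close> an infinite set has supremum \<open>\<infinity>\<close>, so a
  finite packing number forces finitely many cardinalities, and the supremum is their
  maximum.\<close>

lemma pack_attained:
  assumes "pack G \<phi> I A \<noteq> \<infinity>"
  obtains E where "E \<subseteq> carrier G" and "pairwise (\<lambda>x y. \<phi> x ` A \<inter> \<phi> y ` A \<in> I) E"
    and "finite E" and "pack G \<phi> I A = enat (card E)"
proof -
  let ?S = "{E. E \<subseteq> carrier G \<and> pairwise (\<lambda>x y. \<phi> x ` A \<inter> \<phi> y ` A \<in> I) E}"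
  have ne: "ecard ` ?S \<noteq> {}"
    using pairwise_empty by blast
  have fin: "finite (ecard ` ?S)"
    using assms ne by (auto simp: pack_def Sup_enat_def split: if_splits)
  have "pack G \<phi> I A = Max (ecard ` ?S)"
    unfolding pack_def Sup_enat_def if_not_P[OF ne] if_P[OF fin] ..
  then obtain E where E: "E \<in> ?S" "pack G \<phi> I A = ecard E"
    using Max_in[OF fin ne] by auto
  show thesis
  proof (rule that)
    show "finite E" "pack G \<phi> I A = enat (card E)"
      using E(2) assms by (auto simp: ecard_def split: if_splits)
  qed (use E(1) in auto)
qed

section \<open>Closure properties of Boolean ideals\<close>

lemma boolean_ideal_subset:
  assumes "boolean_ideal X I" and "A \<in> I" and "B \<subseteq> A"
  shows "B \<in> I"
proof -
  have "A \<inter> B \<in> I"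
    using assms unfolding boolean_ideal_def by blast
  then show ?thesis
    using assms(3) by (simp add: Int_absorb1)
qed

lemma boolean_ideal_empty:
  assumes "boolean_ideal X I"
  shows "{} \<in> I"
proof -
  obtain A where "A \<in> I"
    using assms by (auto simp: boolean_ideal_def)
  then show ?thesis
    using boolean_ideal_subset[OF assms] by blast
qed

lemma boolean_ideal_UN:
  assumes "boolean_ideal X I" and "finite S" and "\<And>s. s \<in> S \<Longrightarrow> f s \<in> I"
  shows "(\<Union>s\<in>S. f s) \<in> I"
  using assms(2,3)
proof (induction S)
  case empty
  then show ?case
    using boolean_ideal_empty[OF assms(1)] by simp
next
  case (insert s S)
  then have "f s \<in> I" "(\<Union>s\<in>S. f s) \<in> I"
    by auto
  then show ?case
    using assms(1) unfolding boolean_ideal_def by simp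
qed

section \<open>Convolutions and basic bounds on the density\<close>

lemma is12_mono:
  assumes "A \<subseteq> B"
  shows "is12 G X \<phi> A \<le> is12 G X \<phi> B"
  unfolding is12_def
  by (intro INF_mono' SUP_mono') (simp add: measure_pmf.finite_measure_mono assms)

text \<open>The two draws are independent, so they may be swapped; with \<nu> outermost, its points
  can be treated one at a time.\<close>

lemma convolution_eq_bind:
  "convolution \<phi> \<mu> \<nu> = bind_pmf \<nu> (\<lambda>x. map_pmf (\<lambda>a. \<phi> a x) \<mu>)"
  unfolding convolution_def pair_pmf_def
  by (subst bind_commute_pmf) (simp add: map_pmf_def bind_assoc_pmf bind_return_pmf)

text \<open>The measure of \<open>A\<close> is the \<nu>-average of the numbers bounded in the first
  assumption, hence obeys the same bound.\<close>

lemma prob_convolution_le: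
  assumes "\<And>x. x \<in> set_pmf \<nu> \<Longrightarrow> measure_pmf.prob \<mu> {a. \<phi> a x \<in> A} \<le> c" and "0 \<le> c"
  shows "measure_pmf.prob (convolution \<phi> \<mu> \<nu>) A \<le> c"
proof -
  have "emeasure (convolution \<phi> \<mu> \<nu>) A = (\<integral>\<^sup>+x. emeasure \<mu> {a. \<phi> a x \<in> A} \<partial>\<nu>)"
    by (simp add: convolution_eq_bind vimage_def)
  also have "\<dots> \<le> (\<integral>\<^sup>+x. ennreal c \<partial>\<nu>)"
    using assms by (intro nn_integral_mono_AE)
      (auto simp: AE_measure_pmf_iff measure_pmf.emeasure_eq_measure intro: ennreal_leI)
  finally show ?thesis
    using assms(2) by (simp add: measure_pmf.emeasure_eq_measure)
qed

context group_action
begin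

interpretation group G
  using group_hom group_hom.axioms(1) by blast

lemma is12_nonneg:
  assumes "E \<noteq> {}"
  shows "0 \<le> is12 G E \<phi> A"
proof -
  obtain x where "x \<in> E"
    using assms by blast
  then have "return_pmf x \<in> fin_prob E"
    by (simp add: fin_prob_def)
  then show ?thesis
    unfolding is12_def by (intro INF_greatest SUP_upper2) auto
qed

text \<open>One measure \<mu> bounds the infimum, and by averaging only Dirac measures on the space
  have to be tested against it.\<close>

lemma is12_leI:
  assumes "\<mu> \<in> fin_prob (carrier G)" and "0 \<le> c"
    and "\<And>x. x \<in> E \<Longrightarrow> measure_pmf.prob \<mu> {a. \<phi> a x \<in> A} \<le> c"
  shows "is12 G E \<phi> A \<le> ereal c"
  unfolding is12_def
proof (intro INF_lower2[OF assms(1)] SUP_least)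
  fix \<nu> assume "\<nu> \<in> fin_prob E"
  then show "ereal (measure_pmf.prob (convolution \<phi> \<mu> \<nu>) A) \<le> ereal c"
    using assms by (auto simp: fin_prob_def intro!: prob_convolution_le)
qed

lemma is12_le_one: "is12 G E \<phi> A \<le> 1"
  using is12_leI[of "return_pmf \<one>" 1 A] by (simp add: fin_prob_def one_ereal_def)

lemma is12_empty_le: "is12 G E \<phi> {} \<le> 0"
  using is12_leI[of "return_pmf \<one>" 0 "{}"] by (simp add: fin_prob_def zero_ereal_def)

lemma is12_Un_null_le:
  assumes "is12_hat G E \<phi> B = 0" and "C \<subseteq> E" and "E \<noteq> {}"
  shows "is12 G E \<phi> (B \<union> C) \<le> is12 G E \<phi> C"
proof -
  have "is12 G E \<phi> (B \<union> C) - is12 G E \<phi> C \<le> is12_hat G E \<phi> B"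
    unfolding is12_hat_def using assms(2) by (auto intro: SUP_upper)
  \<comment> \<open>Both densities lie in [0, 1], so the extended difference is the real one and can
    be rearranged.\<close>
  then show ?thesis
    using assms(1) is12_nonneg[OF assms(3), of C] is12_nonneg[OF assms(3), of "B \<union> C"]
      is12_le_one[of C] is12_le_one[of "B \<union> C"]
    by (cases "is12 G E \<phi> (B \<union> C)"; cases "is12 G E \<phi> C") auto
qed

section \<open>Disjoint translates and the bound on packings\<close>

lemma act_inv_cancel:
  assumes "g \<in> carrier G" and "x \<in> E"
  shows "\<phi> g (\<phi> (inv g) x) = x"
  using orbit_sym_aux[of "inv g" x] assms by simp

lemma image_act_Int:
  assumes "g \<in> carrier G" and "A \<subseteq> E" and "B \<subseteq> E"
  shows "\<phi> g ` (A \<inter> B) = \<phi> g ` A \<inter> \<phi> g ` B"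
  using inj_on_image_Int[OF inj_prop] assms by simp

lemma is12_le_of_disjoint_translates:
  assumes "F \<subseteq> carrier G" and "finite F" and "F \<noteq> {}"
    and "disjoint_family_on (\<lambda>g. \<phi> g ` A) F"
  shows "is12 G E \<phi> A \<le> ereal (1 / card F)"
proof (rule is12_leI)
  let ?\<mu> = "map_pmf (\<lambda>g. inv g) (pmf_of_set F)"
  show "?\<mu> \<in> fin_prob (carrier G)"
    using assms(1-3) by (auto simp: fin_prob_def)
  fix x assume x: "x \<in> E"
  have "g = h" if "g \<in> F" "h \<in> F" "\<phi> (inv g) x \<in> A" "\<phi> (inv h) x \<in> A" for g h
  proof -
    have "x \<in> \<phi> g ` A \<inter> \<phi> h ` A"
      using that act_inv_cancel[OF _ x] assms(1) by (metis IntI image_eqI subsetD)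
    then show ?thesis
      using disjoint_family_onD[OF assms(4) that(1,2)] by blast
  qed
  then have "card (F \<inter> {g. \<phi> (inv g) x \<in> A}) \<le> 1"
    using assms(2) by (auto simp: card_le_Suc0_iff_eq)
  then show "measure_pmf.prob ?\<mu> {a. \<phi> a x \<in> A} \<le> 1 / card F"
    using assms(2,3) by (simp add: measure_pmf_of_set vimage_def divide_right_mono)
qed simp

lemma is12_le_of_packing:
  assumes "boolean_ideal E I" and "invariant_family G \<phi> I"
    and null: "\<And>B. B \<in> I \<Longrightarrow> is12_hat G E \<phi> B = 0"
    and "A \<subseteq> E" and "E \<noteq> {}"
    and F: "F \<subseteq> carrier G" "finite F" "F \<noteq> {}"
    and pw: "pairwise (\<lambda>x y. \<phi> x ` A \<inter> \<phi> y ` A \<in> I) F"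
  shows "is12 G E \<phi> A \<le> ereal (1 / card F)"
proof -
  \<comment> \<open>\<open>Z\<close> collects all overlaps and \<open>W\<close> pulls them back
    along each element of \<open>F\<close>, so that every translate of \<open>A - W\<close> avoids
    \<open>Z\<close>. Finiteness of \<open>F\<close> keeps both sets in the ideal.\<close>
  define Z where "Z = (\<Union>(g, h)\<in>{(g, h) \<in> F \<times> F. g \<noteq> h}. \<phi> g ` A \<inter> \<phi> h ` A)"
  define W where "W = (\<Union>g\<in>F. \<phi> (inv g) ` Z)"
  have "finite {(g, h) \<in> F \<times> F. g \<noteq> h}"
    using F(2) by (auto intro: finite_subset[of _ "F \<times> F"])
  then have "Z \<in> I"
    unfolding Z_def using pw
    by (intro boolean_ideal_UN[OF assms(1)]) (auto simp: pairwise_def)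
  then have "\<phi> (inv g) ` Z \<in> I" if "g \<in> F" for g
    using that F(1) assms(2) unfolding invariant_family_def by auto
  then have "W \<in> I"
    unfolding W_def by (intro boolean_ideal_UN[OF assms(1) F(2)])
  have "disjoint_family_on (\<lambda>g. \<phi> g ` (A - W)) F"
  proof -
    have False if "g \<in> F" "h \<in> F" "g \<noteq> h" "a \<in> A - W" "b \<in> A - W" "\<phi> g a = \<phi> h b" for g h a b
    proof -
      have "\<phi> g a \<in> \<phi> g ` A \<inter> \<phi> h ` A"
        using that by (metis DiffD1 IntI imageI)
      then have "\<phi> g a \<in> Z"
        unfolding Z_def using that(1-3) by blast
      moreover have "\<phi> (inv g) (\<phi> g a) = a"
        using orbit_sym_aux[of g a] that assms(4) F(1) by blast
      ultimately have "a \<in> W"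
        unfolding W_def using that(1) by (metis UN_I imageI)
      then show False
        using that(4) by blast
    qed
    then show ?thesis
      unfolding disjoint_family_on_def by blast
  qed
  have "is12 G E \<phi> A \<le> is12 G E \<phi> (W \<union> (A - W))"
    by (rule is12_mono) blast
  also have "\<dots> \<le> is12 G E \<phi> (A - W)"
    using is12_Un_null_le[OF null[OF \<open>W \<in> I\<close>]] assms(4,5) by blast
  also have "\<dots> \<le> ereal (1 / card F)"
    by (rule is12_le_of_disjoint_translates) fact+
  finally show ?thesis .
qed

lemma pack_le_inverse_is12:
  assumes "boolean_ideal E I" and "invariant_family G \<phi> I"
    and "\<And>B. B \<in> I \<Longrightarrow> is12_hat G E \<phi> B = 0"
    and "A \<subseteq> E" and "E \<noteq> {}" and "is12 G E \<phi> A = ereal r" and "0 < r"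
  shows "ereal_of_enat (pack G \<phi> I A) \<le> ereal (1 / r)"
proof -
  let ?S = "{F. F \<subseteq> carrier G \<and> pairwise (\<lambda>x y. \<phi> x ` A \<inter> \<phi> y ` A \<in> I) F}"
  have "ereal_of_enat (ecard F) \<le> ereal (1 / r)" if F: "F \<in> ?S" for F
  proof (rule ecard_leI)
    \<comment> \<open>A subset of a packing is a packing, so the density bound for finite packings
      applies to \<open>F'\<close>.\<close>
    fix F' assume F': "finite F'" "F' \<subseteq> F" "F' \<noteq> {}"
    then have "r \<le> 1 / card F'"
      using is12_le_of_packing[OF assms(1-5), of F'] F pairwise_subset[of _ F F'] assms(6) by auto
    moreover have "0 < real (card F')"
      using F' by (simp add: card_gt_0_iff)
    ultimately show "real (card F') \<le> 1 / r"
      using assms(7) by (simp add: field_simps)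
  qed (use assms(7) in simp)
  \<comment> \<open>The embedding into \<open>ereal\<close> is moved inside the supremum over a
    non-empty family; the empty packing is a member.\<close>
  moreover have "?S \<noteq> {}"
    using pairwise_empty by blast
  ultimately show ?thesis
    unfolding pack_def by (subst ereal_of_enat_SUP) (auto intro!: SUP_least)
qed

section \<open>Covering the group by translates of the difference set\<close>

lemma inv_mult_in_Delta:
  assumes "invariant_family G \<phi> I" and "A \<subseteq> E" and "x \<in> carrier G" and "g \<in> carrier G"
    and "\<phi> x ` A \<inter> \<phi> g ` A \<notin> I"
  shows "inv x \<otimes> g \<in> Delta G \<phi> I A"
proof -
  have "\<phi> x (\<phi> (inv x \<otimes> g) a) = \<phi> g a" if "a \<in> A" for a
  proof -
    have a: "a \<in> E"
      using that assms(2) by blast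
    then have "\<phi> g a \<in> E"
      using element_image[OF assms(4)] by blast
    then show ?thesis
      using a assms(3,4) by (simp add: composition_rule act_inv_cancel)
  qed
  then have *: "\<phi> x ` \<phi> (inv x \<otimes> g) ` A = \<phi> g ` A"
    unfolding image_image by (rule image_cong[OF refl])
  have "\<phi> (inv x \<otimes> g) ` A \<subseteq> E"
    using surj_prop[of "inv x \<otimes> g"] assms(2-4) by auto
  then have "\<phi> x ` (A \<inter> \<phi> (inv x \<otimes> g) ` A) = \<phi> x ` A \<inter> \<phi> g ` A"
    using image_act_Int[OF assms(3,2)] * by simp
  \<comment> \<open>Otherwise invariance would put the image under \<open>x\<close>, which is the
    overlap of the two translates, into the ideal.\<close>
  then have "A \<inter> \<phi> (inv x \<otimes> g) ` A \<notin> I"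
    using assms(1,3,5) unfolding invariant_family_def by metis
  then show ?thesis
    using assms(3,4) by (simp add: Delta_def)
qed

lemma cov_Delta_le_pack:
  assumes "boolean_ideal E I" and "invariant_family G \<phi> I" and "A \<subseteq> E" and "A \<notin> I"
  shows "cov G (Delta G \<phi> I A) \<le> pack G \<phi> I A"
proof (cases "pack G \<phi> I A = \<infinity>")
  case False
  then obtain F where F: "F \<subseteq> carrier G" "pairwise (\<lambda>x y. \<phi> x ` A \<inter> \<phi> y ` A \<in> I) F"
      "finite F" "pack G \<phi> I A = enat (card F)"
    by (rule pack_attained)
  \<comment> \<open>Maximality of \<open>F\<close>: a \<open>g\<close> violating this could be added
    to the packing.\<close>
  have meets: "\<exists>x\<in>F. \<phi> x ` A \<inter> \<phi> g ` A \<notin> I" if g: "g \<in> carrier G" for g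
  proof (rule ccontr)
    assume "\<not> ?thesis"
    then have I: "\<phi> x ` A \<inter> \<phi> g ` A \<in> I" if "x \<in> F" for x
      using that by blast
    \<comment> \<open>For \<open>g \<in> F\<close> the overlap of \<open>g\<close> with itself is
      the whole translate, and translating back would give \<open>A \<in> I\<close>. Thus inserting
      \<open>g\<close> really increases the cardinality.\<close>
    have "g \<notin> F"
    proof
      assume "g \<in> F"
      then have "\<phi> (inv g) ` \<phi> g ` A \<in> I"
        using I[of g] assms(2) g unfolding invariant_family_def by simp
      moreover have "\<phi> (inv g) ` \<phi> g ` A = A"
        unfolding image_image using orbit_sym_aux[OF g _ refl] assms(3) by (simp add: subset_iff)
      ultimately show False
        using assms(4) by simp
    qed
    have "pairwise (\<lambda>x y. \<phi> x ` A \<inter> \<phi> y ` A \<in> I) (insert g F)"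
      using F(2) I by (auto simp: pairwise_insert Int_commute)
    then have "ecard (insert g F) \<le> pack G \<phi> I A"
      using F(1) g by (intro pack_ge) auto
    then show False
      using F(3,4) \<open>g \<notin> F\<close> by (simp add: ecard_def)
  qed
  have "carrier G \<subseteq> F <#> Delta G \<phi> I A"
  proof
    fix g assume g: "g \<in> carrier G"
    then obtain x where x: "x \<in> F" "\<phi> x ` A \<inter> \<phi> g ` A \<notin> I"
      using meets by blast
    then have "inv x \<otimes> g \<in> Delta G \<phi> I A"
      using inv_mult_in_Delta[OF assms(2,3)] F(1) g by blast
    moreover have "g = x \<otimes> (inv x \<otimes> g)"
      using x F(1) g by (metis inv_solve_left inv_closed m_closed subsetD)
    ultimately show "g \<in> F <#> Delta G \<phi> I A"
      unfolding set_mult_def using x(1) by blast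
  qed
  moreover have "F <#> Delta G \<phi> I A \<subseteq> carrier G"
    using F(1) by (intro set_mult_closed) (auto simp: Delta_def)
  ultimately have "cov G (Delta G \<phi> I A) \<le> ecard F"
    unfolding cov_def using F(1) by (intro INF_lower) auto
  then show ?thesis
    using F(3,4) by (simp add: ecard_def)
qed simp

end

theorem proposition5p2:
  fixes G :: "('g, 'm) monoid_scheme"
    and X :: "'x set"
    and \<phi> :: "'g \<Rightarrow> 'x \<Rightarrow> 'x"
    and A :: "'x set"
    and I :: "'x set set"
  assumes "group_action G X \<phi>"
    and "A \<subseteq> X"
    and "is12 G X \<phi> A > 0"
    and "boolean_ideal X I"
    and "invariant_family G \<phi> I"
    and "\<And>B. B \<in> I \<Longrightarrow> is12_hat G X \<phi> B = 0"
  shows "cov G (Delta G \<phi> I A) \<le> pack G \<phi> I A \<and>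
         ereal_of_enat (pack G \<phi> I A) \<le> 1 / is12 G X \<phi> A"
proof -
  interpret group_action G X \<phi>
    by fact
  \<comment> \<open>In an empty space \<open>A\<close> would be empty, and the density of the empty
    set is at most 0.\<close>
  have "X \<noteq> {}"
  proof
    assume "X = {}"
    then show False
      using assms(2,3) is12_empty_le by simp
  qed
  \<comment> \<open>Members of the ideal do not raise the density of the empty set, so they cannot
    have positive density.\<close>
  have "A \<notin> I"
  proof
    assume "A \<in> I"
    then have "is12 G X \<phi> A \<le> is12 G X \<phi> {}"
      using is12_Un_null_le[OF assms(6), of A "{}"] \<open>X \<noteq> {}\<close> by simp
    then show False
      using assms(3) is12_empty_le by simp
  qed
  obtain r where r: "is12 G X \<phi> A = ereal r" "0 < r"
    using assms(3) is12_le_one[of A] by (cases "is12 G X \<phi> A") auto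
  then have "1 / is12 G X \<phi> A = ereal (1 / r)"
    by (simp add: one_ereal_def)
  then show ?thesis
    using cov_Delta_le_pack[OF assms(4,5,2) \<open>A \<notin> I\<close>]
      pack_le_inverse_is12[OF assms(4,5,6,2) \<open>X \<noteq> {}\<close> r]
    by simp
qed

end
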